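(* Let $(\mathbb{C},p:\dot{\mathcal{U}}\to\mathcal{U})$ and $(\mathbb{D},q:\dot{\mathcal{V}}\to\mathcal{V})$ be natural models. Specifying a morphism of natural models from $(\mathbb{C},p)$ to $(\mathbb{D},q)$ is equivalent to specifying a premorphism $(F,\varphi,\dot\varphi)$ from $(\mathbb{C},p)$ to $(\mathbb{D},q)$ such that $F$ respects context extension, i.e. $F(\Gamma\cdot A)=F\Gamma\circ FA$ for every object $\Gamma$ of $\mathbb{C}$ and every $A\in\mathcal{U}(\Gamma)$, and such that the canonical morphisms $\tau_A:F(\Gamma\cdot A)\to F\Gamma\circ FA$ of $\mathbb{D}$ are all identity morphisms.
   Context: Write $\mathsf{y}$ for the Yoneda embedding; elements $x\in P(\Gamma)$ of a presheaf are identified with maps $\mathsf{y}(\Gamma)\to P$, and $x[\sigma]=P(\sigma)(x)$. A natural model $(\mathbb{C},p)$ consists of a small category $\mathbb{C}$ with a distinguished terminal object $\diamond$, presheaves $\mathcal{U},\dot{\mathcal{U}}$ on $\mathbb{C}$, a natural transformation $p:\dot{\mathcal{U}}\to\mathcal{U}$ and, for each object $\Gamma$ and $A\in\mathcal{U}(\Gamma)$, a chosen object $\Gamma\cdot A$, morphism $\mathsf{p}_A:\Gamma\cdot A\to\Gamma$ and element $\mathsf{q}_A\in\dot{\mathcal{U}}(\Gamma\cdot A)$ such that the square with top $\mathsf{q}_A$, right $p$, left $\mathsf{y}(\mathsf{p}_A)$, bottom $A$ is a pullback. For $(\mathbb{D},q)$ the chosen data are written $\star$, $\Gamma\circ A$,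 $\mathsf{u}_A$, $\mathsf{v}_A$. **Morphisms.** Natural models are models of an essentially algebraic theory with four sorts: contexts (objects of $\mathbb{C}$), substitutions (morphisms of $\mathbb{C}$), types (elements of $\coprod_\Gamma\mathcal{U}(\Gamma)$) and terms (elements of $\coprod_\Gamma\dot{\mathcal{U}}(\Gamma)$). A morphism of natural models is a homomorphism of models: a quadruple of functions $(F_{\mathsf{Ctx}},F_{\mathsf{Sub}},F_{\mathsf{Type}},F_{\mathsf{Term}})$ between the sorts such that $(F_{\mathsf{Ctx}},F_{\mathsf{Sub}})$ is a functor strictly preserving distinguished terminal objects, $F_{\mathsf{Type}}$ and $F_{\mathsf{Term}}$ respect contexts and substitution, typing is preserved ($F_{\mathsf{Type}}(p_\Gamma(a))=q(F_{\mathsf{Term}}(a))$), and $F_{\mathsf{Ctx}}(\Gamma\cdot A)=F_{\mathsf{Ctx}}(\Gamma)\circ F_{\mathsf{Type}}(A)$, $F_{\mathsf{Sub}}(\mathsf{p}_A)=\mathsf{u}_{F_{\mathsf{Type}}(A)}$, $F_{\mathsf{Term}}(\mathsf{q}_A)=\mathsf{v}_{F_{\mathsf{Type}}(A)}$. **Premorphisms.** For a functor $F:\mathbb{C}\to\mathbb{D}$ let $F_!\dashv F^*$ be the adjunction $\widehat{\mathbb{C}}\rightleftarrows\widehat{\mathbb{D}}$ with $F^*$ precomposition with $F$ (and $F_!$ chosen so that $F_!\mathsf{y}=\mathsf{y}F$). A premorphism is a triple $(F,\varphi,\dot\varphi)$ with $F:\mathbb{C}\to\mathbb{D}$ a functor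 preserving distinguished terminal objects, and natural transformations $\varphi:F_!\mathcal{U}\to\mathcal{V}$, $\dot\varphi:F_!\dot{\mathcal{U}}\to\dot{\mathcal{V}}$ with $q\circ\dot\varphi=\varphi\circ F_!p$; equivalently, by transposing, natural transformations $\varphi:\mathcal{U}\to F^*\mathcal{V}$, $\dot\varphi:\dot{\mathcal{U}}\to F^*\dot{\mathcal{V}}$ with $F^*q\circ\dot\varphi=\varphi\circ p$. In the latter form write $FA=\varphi_\Gamma(A)\in\mathcal{V}(F\Gamma)$ and $Fa=\dot\varphi_\Gamma(a)\in\dot{\mathcal{V}}(F\Gamma)$. For a premorphism and $A\in\mathcal{U}(\Gamma)$, $\tau_A:F(\Gamma\cdot A)\to F\Gamma\circ FA$ is the unique morphism with $\mathsf{u}_{FA}\circ\tau_A=F\mathsf{p}_A$ and $\mathsf{v}_{FA}[\tau_A]=F\mathsf{q}_A$. The correspondence is $F=(F_{\mathsf{Ctx}},F_{\mathsf{Sub}})$, with $\varphi_\Gamma$, $\dot\varphi_\Gamma$ the restrictions of $F_{\mathsf{Type}}$, $F_{\mathsf{Term}}$. *)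

theory Defs
  imports Main "HOL-Library.FuncSet"
begin

section \<open>Small categories, functors and presheaves\<close>

text \<open>Everything is carrier based.  Functors and natural transformations are extensional on their
  carriers, so that HOL equality of the representing functions is equality of the mathematical
  objects; \<open>cmp C g f\<close> is the composite of first \<open>f\<close>, then \<open>g\<close>.\<close>

record ('o, 'a) cat =
  Ob :: "'o set"
  Ar :: "'a set"
  dm :: "'a \<Rightarrow> 'o"
  cd :: "'a \<Rightarrow> 'o"
  idt :: "'o \<Rightarrow> 'a"
  cmp :: "'a \<Rightarrow> 'a \<Rightarrow> 'a"

definition hom :: "('o, 'a) cat \<Rightarrow> 'o \<Rightarrow> 'o \<Rightarrow> 'a set" where
  "hom C X Y = {f \<in> Ar C. dm C f = X \<and> cd C f = Y}"

locale category =
  fixes C :: "('o, 'a) cat"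
  assumes dm_closed: "f \<in> Ar C \<Longrightarrow> dm C f \<in> Ob C"
    and cd_closed: "f \<in> Ar C \<Longrightarrow> cd C f \<in> Ob C"
    and idt_closed: "X \<in> Ob C \<Longrightarrow> idt C X \<in> hom C X X"
    and cmp_closed: "f \<in> hom C X Y \<Longrightarrow> g \<in> hom C Y Z \<Longrightarrow> cmp C g f \<in> hom C X Z"
    and cmp_idt: "f \<in> hom C X Y \<Longrightarrow> cmp C f (idt C X) = f"
    and idt_cmp: "f \<in> hom C X Y \<Longrightarrow> cmp C (idt C Y) f = f"
    and cmp_assoc: "f \<in> hom C W X \<Longrightarrow> g \<in> hom C X Y \<Longrightarrow> h \<in> hom C Y Z \<Longrightarrow>
      cmp C h (cmp C g f) = cmp C (cmp C h g) f"

definition is_terminal :: "('o, 'a) cat \<Rightarrow> 'o \<Rightarrow> bool" where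
  "is_terminal C T \<longleftrightarrow> T \<in> Ob C \<and> (\<forall>X\<in>Ob C. \<exists>!f. f \<in> hom C X T)"

definition functors ::
  "('o1, 'a1) cat \<Rightarrow> ('o2, 'a2) cat \<Rightarrow> (('o1 \<Rightarrow> 'o2) \<times> ('a1 \<Rightarrow> 'a2)) set" where
  "functors C D = {(Fo, Fa).
     Fo \<in> Ob C \<rightarrow>\<^sub>E Ob D \<and> Fa \<in> Ar C \<rightarrow>\<^sub>E Ar D \<and>
     (\<forall>f\<in>Ar C. dm D (Fa f) = Fo (dm C f) \<and> cd D (Fa f) = Fo (cd C f)) \<and>
     (\<forall>X\<in>Ob C. Fa (idt C X) = idt D (Fo X)) \<and>
     (\<forall>f\<in>Ar C. \<forall>g\<in>Ar C. cd C f = dm C g \<longrightarrow> Fa (cmp C g f) = cmp D (Fa g) (Fa f))}"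

record ('o, 'a, 'x) presheaf =
  el :: "'o \<Rightarrow> 'x set"
  act :: "'a \<Rightarrow> 'x \<Rightarrow> 'x"

locale is_presheaf =
  fixes C :: "('o, 'a) cat" and P :: "('o, 'a, 'x) presheaf"
  assumes act_closed: "f \<in> hom C X Y \<Longrightarrow> x \<in> el P Y \<Longrightarrow> act P f x \<in> el P X"
    and act_idt: "X \<in> Ob C \<Longrightarrow> x \<in> el P X \<Longrightarrow> act P (idt C X) x = x"
    and act_cmp: "f \<in> hom C X Y \<Longrightarrow> g \<in> hom C Y Z \<Longrightarrow> x \<in> el P Z \<Longrightarrow>
      act P (cmp C g f) x = act P f (act P g x)"

definition nat_trans ::
  "('o, 'a) cat \<Rightarrow> ('o, 'a, 'x) presheaf \<Rightarrow> ('o, 'a, 'y) presheaf \<Rightarrow> ('o \<Rightarrow> 'x \<Rightarrow> 'y) set" where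
  "nat_trans C P Q = {\<phi>. \<phi> \<in> (\<Pi>\<^sub>E X\<in>Ob C. el P X \<rightarrow>\<^sub>E el Q X) \<and>
     (\<forall>f\<in>Ar C. \<forall>x\<in>el P (cd C f). \<phi> (dm C f) (act P f x) = act Q f (\<phi> (cd C f) x))}"

definition nt_comp ::
  "('o, 'a) cat \<Rightarrow> ('o, 'a, 'x) presheaf \<Rightarrow> ('o \<Rightarrow> 'y \<Rightarrow> 'z) \<Rightarrow> ('o \<Rightarrow> 'x \<Rightarrow> 'y) \<Rightarrow> ('o \<Rightarrow> 'x \<Rightarrow> 'z)" where
  "nt_comp C P \<psi> \<phi> = (\<lambda>X\<in>Ob C. \<lambda>x\<in>el P X. \<psi> X (\<phi> X x))"

definition yo :: "('o, 'a) cat \<Rightarrow> 'o \<Rightarrow> ('o, 'a, 'a) presheaf" where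
  "yo C X = \<lparr>el = (\<lambda>W. hom C W X), act = (\<lambda>f g. cmp C g f)\<rparr>"

definition yo_map :: "('o, 'a) cat \<Rightarrow> 'a \<Rightarrow> 'o \<Rightarrow> 'a \<Rightarrow> 'a" where
  "yo_map C f = (\<lambda>W\<in>Ob C. \<lambda>g\<in>hom C W (dm C f). cmp C f g)"

text \<open>The map from \<open>yo C X\<close> to \<open>P\<close> corresponding to \<open>x \<in> el P X\<close>.\<close>

definition yo_el :: "('o, 'a) cat \<Rightarrow> ('o, 'a, 'x) presheaf \<Rightarrow> 'o \<Rightarrow> 'x \<Rightarrow> 'o \<Rightarrow> 'a \<Rightarrow> 'x" where
  "yo_el C P X x = (\<lambda>W\<in>Ob C. \<lambda>g\<in>hom C W X. act P g x)"

text \<open>The square with corner \<open>P\<close>, top \<open>t : P \<rightarrow> Q\<close>, right \<open>r : Q \<rightarrow> S\<close>, left \<open>l : P \<rightarrow> R\<close> and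
  bottom \<open>b : R \<rightarrow> S\<close> is a pullback of presheaves, tested on cones whose apex has elements of
  type \<open>'z\<close>.  The arrow type of \<open>C\<close> is large enough for \<open>'z\<close>, because it carries the
  representables; see \<open>is_pullback_any_apex\<close> below.\<close>

definition is_pullback ::
  "'z itself \<Rightarrow> ('o, 'a) cat \<Rightarrow> ('o, 'a, 'p) presheaf \<Rightarrow> ('o, 'a, 'q) presheaf \<Rightarrow>
   ('o, 'a, 'r) presheaf \<Rightarrow> ('o, 'a, 's) presheaf \<Rightarrow>
   ('o \<Rightarrow> 'p \<Rightarrow> 'q) \<Rightarrow> ('o \<Rightarrow> 'q \<Rightarrow> 's) \<Rightarrow> ('o \<Rightarrow> 'p \<Rightarrow> 'r) \<Rightarrow> ('o \<Rightarrow> 'r \<Rightarrow> 's) \<Rightarrow> bool" where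
  "is_pullback T C P Q R S t r l b \<longleftrightarrow>
     is_presheaf C P \<and> is_presheaf C Q \<and> is_presheaf C R \<and> is_presheaf C S \<and>
     t \<in> nat_trans C P Q \<and> r \<in> nat_trans C Q S \<and> l \<in> nat_trans C P R \<and> b \<in> nat_trans C R S \<and>
     nt_comp C P r t = nt_comp C P b l \<and>
     (\<forall>X :: ('o, 'a, 'z) presheaf. is_presheaf C X \<longrightarrow>
       (\<forall>f\<in>nat_trans C X Q. \<forall>g\<in>nat_trans C X R. nt_comp C X r f = nt_comp C X b g \<longrightarrow>
         (\<exists>!h. h \<in> nat_trans C X P \<and> nt_comp C X t h = f \<and> nt_comp C X l h = g)))"


section \<open>Natural models and their morphisms\<close>

record ('o, 'a, 't, 'm) nat_model =
  base :: "('o, 'a) cat"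
  emp :: 'o
  Ty :: "('o, 'a, 't) presheaf"
  Tm :: "('o, 'a, 'm) presheaf"
  tymap :: "'o \<Rightarrow> 'm \<Rightarrow> 't"
  ext :: "'o \<Rightarrow> 't \<Rightarrow> 'o"
  prj :: "'o \<Rightarrow> 't \<Rightarrow> 'a"
  var :: "'o \<Rightarrow> 't \<Rightarrow> 'm"

locale natural_model =
  fixes M :: "('o, 'a, 't, 'm) nat_model"
  assumes category: "category (base M)"
    and terminal: "is_terminal (base M) (emp M)"
    and presheaf_Ty: "is_presheaf (base M) (Ty M)"
    and presheaf_Tm: "is_presheaf (base M) (Tm M)"
    and tymap_nat: "tymap M \<in> nat_trans (base M) (Tm M) (Ty M)"
    and ext_closed: "G \<in> Ob (base M) \<Longrightarrow> A \<in> el (Ty M) G \<Longrightarrow> ext M G A \<in> Ob (base M)"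
    and prj_closed: "G \<in> Ob (base M) \<Longrightarrow> A \<in> el (Ty M) G \<Longrightarrow>
      prj M G A \<in> hom (base M) (ext M G A) G"
    and var_closed: "G \<in> Ob (base M) \<Longrightarrow> A \<in> el (Ty M) G \<Longrightarrow>
      var M G A \<in> el (Tm M) (ext M G A)"
    and ext_pullback: "G \<in> Ob (base M) \<Longrightarrow> A \<in> el (Ty M) G \<Longrightarrow>
      is_pullback TYPE('a) (base M)
        (yo (base M) (ext M G A)) (Tm M) (yo (base M) G) (Ty M)
        (yo_el (base M) (Tm M) (ext M G A) (var M G A)) (tymap M)
        (yo_map (base M) (prj M G A)) (yo_el (base M) (Ty M) G A)"

text \<open>The sorts of types and terms, and the operations on the sorts.\<close>

definition Types :: "('o, 'a, 't, 'm) nat_model \<Rightarrow> ('o \<times> 't) set" where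
  "Types M = (SIGMA G:Ob (base M). el (Ty M) G)"

definition Terms :: "('o, 'a, 't, 'm) nat_model \<Rightarrow> ('o \<times> 'm) set" where
  "Terms M = (SIGMA G:Ob (base M). el (Tm M) G)"

definition ty_subst :: "('o, 'a, 't, 'm) nat_model \<Rightarrow> 'o \<times> 't \<Rightarrow> 'a \<Rightarrow> 'o \<times> 't" where
  "ty_subst M A s = (dm (base M) s, act (Ty M) s (snd A))"

definition tm_subst :: "('o, 'a, 't, 'm) nat_model \<Rightarrow> 'o \<times> 'm \<Rightarrow> 'a \<Rightarrow> 'o \<times> 'm" where
  "tm_subst M a s = (dm (base M) s, act (Tm M) s (snd a))"

definition type_of :: "('o, 'a, 't, 'm) nat_model \<Rightarrow> 'o \<times> 'm \<Rightarrow> 'o \<times> 't" where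
  "type_of M a = (fst a, tymap M (fst a) (snd a))"

definition Ext :: "('o, 'a, 't, 'm) nat_model \<Rightarrow> 'o \<times> 't \<Rightarrow> 'o" where
  "Ext M A = ext M (fst A) (snd A)"

definition Prj :: "('o, 'a, 't, 'm) nat_model \<Rightarrow> 'o \<times> 't \<Rightarrow> 'a" where
  "Prj M A = prj M (fst A) (snd A)"

definition Var :: "('o, 'a, 't, 'm) nat_model \<Rightarrow> 'o \<times> 't \<Rightarrow> 'o \<times> 'm" where
  "Var M A = (Ext M A, var M (fst A) (snd A))"

type_synonym ('o1, 'a1, 't1, 'm1, 'o2, 'a2, 't2, 'm2) quadruple =
  "('o1 \<Rightarrow> 'o2) \<times> ('a1 \<Rightarrow> 'a2) \<times> ('o1 \<times> 't1 \<Rightarrow> 'o2 \<times> 't2) \<times> ('o1 \<times> 'm1 \<Rightarrow> 'o2 \<times> 'm2)"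

definition nm_morphisms ::
  "('o1, 'a1, 't1, 'm1) nat_model \<Rightarrow> ('o2, 'a2, 't2, 'm2) nat_model \<Rightarrow>
   ('o1, 'a1, 't1, 'm1, 'o2, 'a2, 't2, 'm2) quadruple set" where
  "nm_morphisms M N = {(FCtx, FSub, FType, FTerm).
     (FCtx, FSub) \<in> functors (base M) (base N) \<and>
     FCtx (emp M) = emp N \<and>
     FType \<in> Types M \<rightarrow>\<^sub>E Types N \<and> FTerm \<in> Terms M \<rightarrow>\<^sub>E Terms N \<and>
     (\<forall>A\<in>Types M. fst (FType A) = FCtx (fst A)) \<and>
     (\<forall>a\<in>Terms M. fst (FTerm a) = FCtx (fst a)) \<and>
     (\<forall>A\<in>Types M. \<forall>s\<in>Ar (base M). cd (base M) s = fst A \<longrightarrow>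
        FType (ty_subst M A s) = ty_subst N (FType A) (FSub s)) \<and>
     (\<forall>a\<in>Terms M. \<forall>s\<in>Ar (base M). cd (base M) s = fst a \<longrightarrow>
        FTerm (tm_subst M a s) = tm_subst N (FTerm a) (FSub s)) \<and>
     (\<forall>a\<in>Terms M. FType (type_of M a) = type_of N (FTerm a)) \<and>
     (\<forall>A\<in>Types M. FCtx (Ext M A) = Ext N (FType A)) \<and>
     (\<forall>A\<in>Types M. FSub (Prj M A) = Prj N (FType A)) \<and>
     (\<forall>A\<in>Types M. FTerm (Var M A) = Var N (FType A))}"


section \<open>Precomposition and its left adjoint\<close>

definition precomp ::
  "('o1 \<Rightarrow> 'o2) \<times> ('a1 \<Rightarrow> 'a2) \<Rightarrow> ('o2, 'a2, 'y) presheaf \<Rightarrow> ('o1, 'a1, 'y) presheaf" where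
  "precomp F Q = \<lparr>el = (\<lambda>X. el Q (fst F X)), act = (\<lambda>f. act Q (snd F f))\<rparr>"

definition precomp_map ::
  "('o1, 'a1) cat \<Rightarrow> ('o1 \<Rightarrow> 'o2) \<times> ('a1 \<Rightarrow> 'a2) \<Rightarrow> ('o2 \<Rightarrow> 'x \<Rightarrow> 'y) \<Rightarrow> 'o1 \<Rightarrow> 'x \<Rightarrow> 'y" where
  "precomp_map C F \<psi> = (\<lambda>X\<in>Ob C. \<psi> (fst F X))"

text \<open>The left adjoint is the left Kan extension, given pointwise by the coend formula: an element
  at \<open>d\<close> is a class of triples \<open>(X, g, x)\<close> with \<open>g : d \<rightarrow> F X\<close> and \<open>x \<in> P(X)\<close>, where
  \<open>(X, g, x[f])\<close> is identified with \<open>(Y, F f \<circ> g, x)\<close> for \<open>f : X \<rightarrow> Y\<close>.\<close>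

definition lan_pre ::
  "('o1, 'a1) cat \<Rightarrow> ('o2, 'a2) cat \<Rightarrow> ('o1 \<Rightarrow> 'o2) \<times> ('a1 \<Rightarrow> 'a2) \<Rightarrow>
   ('o1, 'a1, 'x) presheaf \<Rightarrow> 'o2 \<Rightarrow> ('o1 \<times> 'a2 \<times> 'x) set" where
  "lan_pre C D F P d = {(X, g, x). X \<in> Ob C \<and> g \<in> hom D d (fst F X) \<and> x \<in> el P X}"

definition lan_step ::
  "('o1, 'a1) cat \<Rightarrow> ('o2, 'a2) cat \<Rightarrow> ('o1 \<Rightarrow> 'o2) \<times> ('a1 \<Rightarrow> 'a2) \<Rightarrow>
   ('o1, 'a1, 'x) presheaf \<Rightarrow> 'o2 \<Rightarrow> (('o1 \<times> 'a2 \<times> 'x) \<times> ('o1 \<times> 'a2 \<times> 'x)) set" where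
  "lan_step C D F P d = {((dm C f, g, act P f x), (cd C f, cmp D (snd F f) g, x)) | f g x.
     f \<in> Ar C \<and> g \<in> hom D d (fst F (dm C f)) \<and> x \<in> el P (cd C f)}"

definition lan_eq ::
  "('o1, 'a1) cat \<Rightarrow> ('o2, 'a2) cat \<Rightarrow> ('o1 \<Rightarrow> 'o2) \<times> ('a1 \<Rightarrow> 'a2) \<Rightarrow>
   ('o1, 'a1, 'x) presheaf \<Rightarrow> 'o2 \<Rightarrow> (('o1 \<times> 'a2 \<times> 'x) \<times> ('o1 \<times> 'a2 \<times> 'x)) set" where
  "lan_eq C D F P d = (lan_step C D F P d \<union> (lan_step C D F P d)\<inverse>)\<^sup>*"

definition lan_cls ::
  "('o1, 'a1) cat \<Rightarrow> ('o2, 'a2) cat \<Rightarrow> ('o1 \<Rightarrow> 'o2) \<times> ('a1 \<Rightarrow> 'a2) \<Rightarrow>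
   ('o1, 'a1, 'x) presheaf \<Rightarrow> 'o2 \<Rightarrow> 'o1 \<times> 'a2 \<times> 'x \<Rightarrow> ('o1 \<times> 'a2 \<times> 'x) set" where
  "lan_cls C D F P d t = lan_eq C D F P d `` {t}"

definition lan ::
  "('o1, 'a1) cat \<Rightarrow> ('o2, 'a2) cat \<Rightarrow> ('o1 \<Rightarrow> 'o2) \<times> ('a1 \<Rightarrow> 'a2) \<Rightarrow>
   ('o1, 'a1, 'x) presheaf \<Rightarrow> ('o2, 'a2, ('o1 \<times> 'a2 \<times> 'x) set) presheaf" where
  "lan C D F P = \<lparr>
     el = (\<lambda>d. lan_pre C D F P d // lan_eq C D F P d),
     act = (\<lambda>h K. \<Union>(X, g, x)\<in>K. lan_cls C D F P (dm D h) (X, cmp D g h, x))\<rparr>"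

definition lan_map ::
  "('o1, 'a1) cat \<Rightarrow> ('o2, 'a2) cat \<Rightarrow> ('o1 \<Rightarrow> 'o2) \<times> ('a1 \<Rightarrow> 'a2) \<Rightarrow>
   ('o1, 'a1, 'x) presheaf \<Rightarrow> ('o1, 'a1, 'y) presheaf \<Rightarrow> ('o1 \<Rightarrow> 'x \<Rightarrow> 'y) \<Rightarrow>
   'o2 \<Rightarrow> ('o1 \<times> 'a2 \<times> 'x) set \<Rightarrow> ('o1 \<times> 'a2 \<times> 'y) set" where
  "lan_map C D F P Q \<phi> = (\<lambda>d\<in>Ob D. \<lambda>K\<in>el (lan C D F P) d.
     \<Union>(X, g, x)\<in>K. lan_cls C D F Q d (X, g, \<phi> X x))"

text \<open>Transposition along the unit \<open>x \<mapsto> [(X, id, x)]\<close>; see \<open>bij_betw_transpose_nt\<close> below.\<close>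

definition transpose_nt ::
  "('o1, 'a1) cat \<Rightarrow> ('o2, 'a2) cat \<Rightarrow> ('o1 \<Rightarrow> 'o2) \<times> ('a1 \<Rightarrow> 'a2) \<Rightarrow>
   ('o1, 'a1, 'x) presheaf \<Rightarrow> ('o2 \<Rightarrow> ('o1 \<times> 'a2 \<times> 'x) set \<Rightarrow> 'y) \<Rightarrow> 'o1 \<Rightarrow> 'x \<Rightarrow> 'y" where
  "transpose_nt C D F P \<phi> = (\<lambda>X\<in>Ob C. \<lambda>x\<in>el P X.
     \<phi> (fst F X) (lan_cls C D F P (fst F X) (X, idt D (fst F X), x)))"


section \<open>Premorphisms\<close>

definition premorphisms ::
  "('o1, 'a1, 't1, 'm1) nat_model \<Rightarrow> ('o2, 'a2, 't2, 'm2) nat_model \<Rightarrow>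
   ((('o1 \<Rightarrow> 'o2) \<times> ('a1 \<Rightarrow> 'a2)) \<times> ('o2 \<Rightarrow> ('o1 \<times> 'a2 \<times> 't1) set \<Rightarrow> 't2) \<times>
    ('o2 \<Rightarrow> ('o1 \<times> 'a2 \<times> 'm1) set \<Rightarrow> 'm2)) set" where
  "premorphisms M N = {(F, \<phi>, \<psi>).
     F \<in> functors (base M) (base N) \<and> fst F (emp M) = emp N \<and>
     \<phi> \<in> nat_trans (base N) (lan (base M) (base N) F (Ty M)) (Ty N) \<and>
     \<psi> \<in> nat_trans (base N) (lan (base M) (base N) F (Tm M)) (Tm N) \<and>
     nt_comp (base N) (lan (base M) (base N) F (Tm M)) (tymap N) \<psi> =
     nt_comp (base N) (lan (base M) (base N) F (Tm M)) \<phi>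
       (lan_map (base M) (base N) F (Tm M) (Ty M) (tymap M))}"

type_synonym ('o1, 'a1, 't1, 'm1, 'o2, 'a2, 't2, 'm2) triple =
  "(('o1 \<Rightarrow> 'o2) \<times> ('a1 \<Rightarrow> 'a2)) \<times> ('o1 \<Rightarrow> 't1 \<Rightarrow> 't2) \<times> ('o1 \<Rightarrow> 'm1 \<Rightarrow> 'm2)"

text \<open>Premorphisms in transposed form; here \<open>\<phi> G A\<close> and \<open>\<psi> G a\<close> are \<open>F A\<close> and \<open>F a\<close>.\<close>

definition tr_premorphisms ::
  "('o1, 'a1, 't1, 'm1) nat_model \<Rightarrow> ('o2, 'a2, 't2, 'm2) nat_model \<Rightarrow>
   ('o1, 'a1, 't1, 'm1, 'o2, 'a2, 't2, 'm2) triple set" where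
  "tr_premorphisms M N = {(F, \<phi>, \<psi>).
     F \<in> functors (base M) (base N) \<and> fst F (emp M) = emp N \<and>
     \<phi> \<in> nat_trans (base M) (Ty M) (precomp F (Ty N)) \<and>
     \<psi> \<in> nat_trans (base M) (Tm M) (precomp F (Tm N)) \<and>
     nt_comp (base M) (Tm M) (precomp_map (base M) F (tymap N)) \<psi> =
     nt_comp (base M) (Tm M) \<phi> (tymap M)}"

fun tr_premorphism ::
  "('o1, 'a1, 't1, 'm1) nat_model \<Rightarrow> ('o2, 'a2, 't2, 'm2) nat_model \<Rightarrow>
   (('o1 \<Rightarrow> 'o2) \<times> ('a1 \<Rightarrow> 'a2)) \<times> ('o2 \<Rightarrow> ('o1 \<times> 'a2 \<times> 't1) set \<Rightarrow> 't2) \<times>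
    ('o2 \<Rightarrow> ('o1 \<times> 'a2 \<times> 'm1) set \<Rightarrow> 'm2) \<Rightarrow>
   ('o1, 'a1, 't1, 'm1, 'o2, 'a2, 't2, 'm2) triple" where
  "tr_premorphism M N (F, \<phi>, \<psi>) =
     (F, transpose_nt (base M) (base N) F (Ty M) \<phi>, transpose_nt (base M) (base N) F (Tm M) \<psi>)"

fun tau ::
  "('o1, 'a1, 't1, 'm1) nat_model \<Rightarrow> ('o2, 'a2, 't2, 'm2) nat_model \<Rightarrow>
   ('o1, 'a1, 't1, 'm1, 'o2, 'a2, 't2, 'm2) triple \<Rightarrow> 'o1 \<Rightarrow> 't1 \<Rightarrow> 'a2" where
  "tau M N (F, \<phi>, \<psi>) G A = (THE t.
     t \<in> hom (base N) (fst F (ext M G A)) (ext N (fst F G) (\<phi> G A)) \<and>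
     cmp (base N) (prj N (fst F G) (\<phi> G A)) t = snd F (prj M G A) \<and>
     act (Tm N) t (var N (fst F G) (\<phi> G A)) = \<psi> (ext M G A) (var M G A))"

fun respects_ext ::
  "('o1, 'a1, 't1, 'm1) nat_model \<Rightarrow> ('o2, 'a2, 't2, 'm2) nat_model \<Rightarrow>
   ('o1, 'a1, 't1, 'm1, 'o2, 'a2, 't2, 'm2) triple \<Rightarrow> bool" where
  "respects_ext M N (F, \<phi>, \<psi>) \<longleftrightarrow>
     (\<forall>G\<in>Ob (base M). \<forall>A\<in>el (Ty M) G. fst F (ext M G A) = ext N (fst F G) (\<phi> G A))"

definition tau_identities ::
  "('o1, 'a1, 't1, 'm1) nat_model \<Rightarrow> ('o2, 'a2, 't2, 'm2) nat_model \<Rightarrow>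
   ('o1, 'a1, 't1, 'm1, 'o2, 'a2, 't2, 'm2) triple \<Rightarrow> bool" where
  "tau_identities M N p \<longleftrightarrow>
     (\<forall>G\<in>Ob (base M). \<forall>A\<in>el (Ty M) G. tau M N p G A = idt (base N) (fst (fst p) (ext M G A)))"

text \<open>The functor together with the restrictions of \<open>FType\<close> and \<open>FTerm\<close> to the fibres over each context.\<close>

fun triple_of ::
  "('o1, 'a1, 't1, 'm1) nat_model \<Rightarrow>
   ('o1, 'a1, 't1, 'm1, 'o2, 'a2, 't2, 'm2) quadruple \<Rightarrow>
   ('o1, 'a1, 't1, 'm1, 'o2, 'a2, 't2, 'm2) triple" where
  "triple_of M (FCtx, FSub, FType, FTerm) =
     ((FCtx, FSub),
      \<lambda>G\<in>Ob (base M). \<lambda>A\<in>el (Ty M) G. snd (FType (G, A)),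
      \<lambda>G\<in>Ob (base M). \<lambda>a\<in>el (Tm M) G. snd (FTerm (G, a)))"


section \<open>Adequacy of the encodings\<close>

lemma homD: "f \<in> hom C X Y \<Longrightarrow> f \<in> Ar C \<and> dm C f = X \<and> cd C f = Y"
  by (simp add: hom_def)

lemma homI: "f \<in> Ar C \<Longrightarrow> f \<in> hom C (dm C f) (cd C f)"
  by (simp add: hom_def)

lemma (in category) hom_Ob: "f \<in> hom C X Y \<Longrightarrow> X \<in> Ob C \<and> Y \<in> Ob C"
  using dm_closed cd_closed by (auto simp: hom_def)

lemma nat_transI:
  assumes "\<phi> \<in> (\<Pi>\<^sub>E X\<in>Ob C. el P X \<rightarrow>\<^sub>E el Q X)"
    and "\<And>X Y f x. f \<in> hom C X Y \<Longrightarrow> x \<in> el P Y \<Longrightarrow> \<phi> X (act P f x) = act Q f (\<phi> Y x)"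
  shows "\<phi> \<in> nat_trans C P Q"
  using assms by (auto simp: nat_trans_def homI)

lemma nat_trans_closed:
  "\<phi> \<in> nat_trans C P Q \<Longrightarrow> X \<in> Ob C \<Longrightarrow> x \<in> el P X \<Longrightarrow> \<phi> X x \<in> el Q X"
  by (auto simp: nat_trans_def dest!: PiE_mem)

lemma nat_trans_act:
  "\<phi> \<in> nat_trans C P Q \<Longrightarrow> f \<in> hom C X Y \<Longrightarrow> x \<in> el P Y \<Longrightarrow> \<phi> X (act P f x) = act Q f (\<phi> Y x)"
  by (auto simp: nat_trans_def hom_def)

lemma nat_trans_ext:
  assumes "\<phi> \<in> nat_trans C P Q" "\<psi> \<in> nat_trans C P Q'"
    and "\<And>X x. X \<in> Ob C \<Longrightarrow> x \<in> el P X \<Longrightarrow> \<phi> X x = \<psi> X x"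
  shows "\<phi> = \<psi>"
proof
  fix X
  show "\<phi> X = \<psi> X"
  proof (cases "X \<in> Ob C")
    case True
    then have "\<phi> X \<in> el P X \<rightarrow>\<^sub>E el Q X" "\<psi> X \<in> el P X \<rightarrow>\<^sub>E el Q' X"
      using assms(1,2) by (auto simp: nat_trans_def PiE_def Pi_def)
    then show ?thesis
      using assms(3) True by (intro extensionalityI[of _ "el P X"]) (auto simp: PiE_def)
  next
    case False
    then show ?thesis
      using assms(1,2) by (auto simp: nat_trans_def PiE_def extensional_def)
  qed
qed

lemma nt_comp_closed:
  assumes "category C" "is_presheaf C P" "\<phi> \<in> nat_trans C P Q" "\<psi> \<in> nat_trans C Q R"
  shows "nt_comp C P \<psi> \<phi> \<in> nat_trans C P R"
proof (rule nat_transI)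
  show "nt_comp C P \<psi> \<phi> \<in> (\<Pi>\<^sub>E X\<in>Ob C. el P X \<rightarrow>\<^sub>E el R X)"
    using nat_trans_closed[OF assms(3)] nat_trans_closed[OF assms(4)] by (auto simp: nt_comp_def)
next
  fix X Y f x
  assume f: "f \<in> hom C X Y" and x: "x \<in> el P Y"
  then show "nt_comp C P \<psi> \<phi> X (act P f x) = act R f (nt_comp C P \<psi> \<phi> Y x)"
    using category.hom_Ob[OF assms(1) f] is_presheaf.act_closed[OF assms(2) f x]
      nat_trans_act[OF assms(3) f x] nat_trans_act[OF assms(4) f] nat_trans_closed[OF assms(3)]
    by (simp add: nt_comp_def)
qed

lemma nt_compD: "nt_comp C P \<psi> \<phi> = nt_comp C P \<psi>' \<phi>' \<Longrightarrow> X \<in> Ob C \<Longrightarrow> x \<in> el P X \<Longrightarrow>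
    \<psi> X (\<phi> X x) = \<psi>' X (\<phi>' X x)"
  by (auto simp: nt_comp_def dest!: fun_cong[of _ _ X] split: if_splits) (metis restrict_apply')

lemma nt_compI: "(\<And>X x. X \<in> Ob C \<Longrightarrow> x \<in> el P X \<Longrightarrow> \<psi> X (\<phi> X x) = \<psi>' X (\<phi>' X x)) \<Longrightarrow>
    nt_comp C P \<psi> \<phi> = nt_comp C P \<psi>' \<phi>'"
  unfolding nt_comp_def by (intro restrict_ext) auto

lemma is_presheaf_yo:
  assumes "category C" shows "is_presheaf C (yo C X)"
  using assms by unfold_locales
    (auto simp: yo_def intro: category.cmp_closed category.cmp_idt category.cmp_assoc)

lemma yo_el_nat_trans:
  assumes "category C" "is_presheaf C P" "x \<in> el P X"
  shows "yo_el C P X x \<in> nat_trans C (yo C X) P"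
  using assms
  by (intro nat_transI)
    (auto simp: yo_el_def yo_def is_presheaf.act_closed is_presheaf.act_cmp
      category.cmp_closed dest: category.hom_Ob)

lemma yo_map_nat_trans:
  assumes "category C" "f \<in> hom C X Y"
  shows "yo_map C f \<in> nat_trans C (yo C X) (yo C Y)"
  using assms homD[OF assms(2)]
  by (intro nat_transI)
    (auto simp: yo_map_def yo_def category.cmp_closed category.cmp_assoc dest: category.hom_Ob)

lemma yo_nat_trans_eq:
  assumes "category C" "\<phi> \<in> nat_trans C (yo C X) P" "W \<in> Ob C" "g \<in> hom C W X"
  shows "\<phi> W g = act P g (\<phi> X (idt C X))"
proof -
  have "X \<in> Ob C" using category.hom_Ob[OF assms(1,4)] by simp
  then show ?thesis
    using nat_trans_act[OF assms(2,4), of "idt C X"] assms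
    by (simp add: yo_def category.idt_closed category.idt_cmp)
qed

lemma is_pullback_pointwise:
  fixes C :: "('o, 'a) cat"
  assumes C: "category C" and pb: "is_pullback TYPE('a) C P Q R S t r l b"
    and X: "X \<in> Ob C" and x: "x \<in> el Q X" and y: "y \<in> el R X" and xy: "r X x = b X y"
  shows "\<exists>!z. z \<in> el P X \<and> t X z = x \<and> l X z = y"
proof -
  note pb' = pb[unfolded is_pullback_def]
  have nt: "r \<in> nat_trans C Q S" "b \<in> nat_trans C R S" "t \<in> nat_trans C P Q" "l \<in> nat_trans C P R"
    and ps: "is_presheaf C P" "is_presheaf C Q" "is_presheaf C R"
    using pb' by auto
  let ?Y = "yo C X" and ?f = "yo_el C Q X x" and ?g = "yo_el C R X y"
  have Y: "is_presheaf C ?Y" by (rule is_presheaf_yo[OF C])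
  have f: "?f \<in> nat_trans C ?Y Q" and g: "?g \<in> nat_trans C ?Y R"
    by (rule yo_el_nat_trans[OF C ps(2) x], rule yo_el_nat_trans[OF C ps(3) y])
  have i: "idt C X \<in> hom C X X" by (rule category.idt_closed[OF C X])
  have fi: "?f X (idt C X) = x" "?g X (idt C X) = y"
    using X x y i ps by (auto simp: yo_el_def is_presheaf.act_idt)
  have "nt_comp C ?Y r ?f = nt_comp C ?Y b ?g"
  proof (rule nt_compI)
    fix W h assume "W \<in> Ob C" "h \<in> el ?Y W"
    then show "r W (?f W h) = b W (?g W h)"
      using x y xy nt by (simp add: yo_el_def yo_def nat_trans_act)
  qed
  then have ex1: "\<exists>!h. h \<in> nat_trans C ?Y P \<and> nt_comp C ?Y t h = ?f \<and> nt_comp C ?Y l h = ?g"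
    using pb' Y f g by blast
  then obtain h where h: "h \<in> nat_trans C ?Y P" "nt_comp C ?Y t h = ?f" "nt_comp C ?Y l h = ?g"
    by blast
  have iY: "idt C X \<in> el ?Y X" using i by (simp add: yo_def)
  show ?thesis
  proof (rule ex1I[of _ "h X (idt C X)"])
    have "t X (h X (idt C X)) = ?f X (idt C X)" "l X (h X (idt C X)) = ?g X (idt C X)"
      using h(2,3) X iY by (auto simp: nt_comp_def dest!: fun_cong[of _ _ X] fun_cong[of _ _ "idt C X"])
    then show "h X (idt C X) \<in> el P X \<and> t X (h X (idt C X)) = x \<and> l X (h X (idt C X)) = y"
      using fi nat_trans_closed[OF h(1) X iY] by auto
  next
    fix z assume z: "z \<in> el P X \<and> t X z = x \<and> l X z = y"
    let ?k = "yo_el C P X z"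
    have k: "?k \<in> nat_trans C ?Y P" using yo_el_nat_trans[OF C ps(1)] z by auto
    have "nt_comp C ?Y t ?k = ?f"
      by (rule nat_trans_ext[OF nt_comp_closed[OF C Y k nt(3)] f])
        (use z nt(3) in \<open>auto simp: nt_comp_def yo_el_def yo_def nat_trans_act\<close>)
    moreover have "nt_comp C ?Y l ?k = ?g"
      by (rule nat_trans_ext[OF nt_comp_closed[OF C Y k nt(4)] g])
        (use z nt(4) in \<open>auto simp: nt_comp_def yo_el_def yo_def nat_trans_act\<close>)
    ultimately have "?k = h" using ex1 h k by blast
    then have "h X (idt C X) = act P (idt C X) z" using X i by (auto simp: yo_el_def)
    then show "z = h X (idt C X)" using z X ps by (simp add: is_presheaf.act_idt)
  qed
qed

lemma is_pullback_any_apex: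
  fixes C :: "('o, 'a) cat"
  assumes C: "category C" and pb: "is_pullback TYPE('a) C P Q R S t r l b"
  shows "is_pullback TYPE('z) C P Q R S t r l b"
proof -
  note pb' = pb[unfolded is_pullback_def]
  have nt: "r \<in> nat_trans C Q S" "b \<in> nat_trans C R S" "t \<in> nat_trans C P Q" "l \<in> nat_trans C P R"
    and ps: "is_presheaf C P" "is_presheaf C Q" "is_presheaf C R"
    using pb' by auto
  have "\<exists>!h. h \<in> nat_trans C X P \<and> nt_comp C X t h = f \<and> nt_comp C X l h = g"
    if X: "is_presheaf C X" and f: "f \<in> nat_trans C X Q" and g: "g \<in> nat_trans C X R"
      and fg: "nt_comp C X r f = nt_comp C X b g" for X :: "('o, 'a, 'z) presheaf" and f g
  proof -
    have ex1: "\<exists>!z. z \<in> el P W \<and> t W z = f W x \<and> l W z = g W x"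
      if "W \<in> Ob C" "x \<in> el X W" for W x
      using that nat_trans_closed[OF f] nat_trans_closed[OF g] nt_compD[OF fg]
      by (intro is_pullback_pointwise[OF C pb]) auto
    define h where "h = (\<lambda>W\<in>Ob C. \<lambda>x\<in>el X W. THE z. z \<in> el P W \<and> t W z = f W x \<and> l W z = g W x)"
    have h: "h W x \<in> el P W \<and> t W (h W x) = f W x \<and> l W (h W x) = g W x"
      if "W \<in> Ob C" "x \<in> el X W" for W x
      using theI'[OF ex1[OF that]] that by (simp add: h_def)
    have hn: "h \<in> nat_trans C X P"
    proof (rule nat_transI)
      show "h \<in> (\<Pi>\<^sub>E W\<in>Ob C. el X W \<rightarrow>\<^sub>E el P W)"
      proof
        fix W assume W: "W \<in> Ob C"
        show "h W \<in> el X W \<rightarrow>\<^sub>E el P W"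
          using h[OF W] by (auto simp: PiE_def Pi_def) (simp add: h_def W)
      qed (simp add: h_def)
    next
      fix W Y k x assume k: "k \<in> hom C W Y" and x: "x \<in> el X Y"
      have WY: "W \<in> Ob C" "Y \<in> Ob C" using category.hom_Ob[OF C k] by auto
      have kx: "act X k x \<in> el X W" by (rule is_presheaf.act_closed[OF X k x])
      have "act P k (h Y x) \<in> el P W"
        using h[OF WY(2) x] is_presheaf.act_closed[OF ps(1) k] by blast
      moreover have "t W (act P k (h Y x)) = f W (act X k x)" "l W (act P k (h Y x)) = g W (act X k x)"
        using h[OF WY(2) x] nat_trans_act[OF nt(3) k] nat_trans_act[OF nt(4) k]
          nat_trans_act[OF f k x] nat_trans_act[OF g k x] by auto
      ultimately show "h W (act X k x) = act P k (h Y x)"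
        using ex1[OF WY(1) kx] h[OF WY(1) kx] by blast
    qed
    show ?thesis
    proof (rule ex1I[of _ h], intro conjI)
      show "nt_comp C X t h = f"
        by (rule nat_trans_ext[OF nt_comp_closed[OF C X hn nt(3)] f]) (simp add: nt_comp_def h)
      show "nt_comp C X l h = g"
        by (rule nat_trans_ext[OF nt_comp_closed[OF C X hn nt(4)] g]) (simp add: nt_comp_def h)
    next
      fix k assume k: "k \<in> nat_trans C X P \<and> nt_comp C X t k = f \<and> nt_comp C X l k = g"
      show "k = h"
      proof (rule nat_trans_ext[OF conjunct1[OF k] hn])
        fix W x assume Wx: "W \<in> Ob C" "x \<in> el X W"
        have "t W (k W x) = f W x" "l W (k W x) = g W x"
          using k Wx by (auto simp: nt_comp_def)
        then show "k W x = h W x"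
          using ex1[OF Wx] h[OF Wx] nat_trans_closed[OF conjunct1[OF k] Wx] by blast
      qed
    qed (rule hn)
  qed
  then show ?thesis using pb' unfolding is_pullback_def by blast
qed

lemma functors_hom:
  "F \<in> functors C D \<Longrightarrow> f \<in> hom C X Y \<Longrightarrow> snd F f \<in> hom D (fst F X) (fst F Y)"
  by (auto simp: functors_def hom_def)

lemma functors_Ob: "F \<in> functors C D \<Longrightarrow> X \<in> Ob C \<Longrightarrow> fst F X \<in> Ob D"
  by (auto simp: functors_def)

lemma functors_idt: "F \<in> functors C D \<Longrightarrow> X \<in> Ob C \<Longrightarrow> snd F (idt C X) = idt D (fst F X)"
  by (auto simp: functors_def)

lemma functors_cmp: "F \<in> functors C D \<Longrightarrow> f \<in> hom C X Y \<Longrightarrow> g \<in> hom C Y Z \<Longrightarrow>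
    snd F (cmp C g f) = cmp D (snd F g) (snd F f)"
  by (auto simp: functors_def hom_def)

lemma is_presheaf_precomp:
  assumes "F \<in> functors C D" "is_presheaf D Q"
  shows "is_presheaf C (precomp F Q)"
  using assms
  by unfold_locales (auto simp: precomp_def functors_idt functors_cmp functors_Ob
    is_presheaf.act_idt dest: functors_hom intro: is_presheaf.act_closed is_presheaf.act_cmp)

text \<open>The defining property of \<open>\<tau>\<close> has exactly one solution.\<close>

lemma tau_ex1:
  assumes M: "natural_model M" and N: "natural_model N" and p: "(F, \<phi>, \<psi>) \<in> tr_premorphisms M N"
    and G: "G \<in> Ob (base M)" and A: "A \<in> el (Ty M) G"
  shows "\<exists>!t. t \<in> hom (base N) (fst F (ext M G A)) (ext N (fst F G) (\<phi> G A)) \<and>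
     cmp (base N) (prj N (fst F G) (\<phi> G A)) t = snd F (prj M G A) \<and>
     act (Tm N) t (var N (fst F G) (\<phi> G A)) = \<psi> (ext M G A) (var M G A)"
proof -
  let ?C = "base M" and ?D = "base N" and ?E = "ext M G A"
  have C: "category ?C" and D: "category ?D"
    using M N by (auto simp: natural_model.category)
  have F: "F \<in> functors ?C ?D" and \<phi>: "\<phi> \<in> nat_trans ?C (Ty M) (precomp F (Ty N))"
    and \<psi>: "\<psi> \<in> nat_trans ?C (Tm M) (precomp F (Tm N))"
    and eq: "nt_comp ?C (Tm M) (precomp_map ?C F (tymap N)) \<psi> = nt_comp ?C (Tm M) \<phi> (tymap M)"
    using p by (auto simp: tr_premorphisms_def)
  have FG: "fst F G \<in> Ob ?D" and FA: "\<phi> G A \<in> el (Ty N) (fst F G)"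
    using functors_Ob[OF F G] nat_trans_closed[OF \<phi> G A] by (auto simp: precomp_def)
  have E: "?E \<in> Ob ?C" by (rule natural_model.ext_closed[OF M G A])
  have FE: "fst F ?E \<in> Ob ?D" by (rule functors_Ob[OF F E])
  have pr: "prj M G A \<in> hom ?C ?E G" and v: "var M G A \<in> el (Tm M) ?E"
    using natural_model.prj_closed[OF M G A] natural_model.var_closed[OF M G A] by auto
  have Fp: "snd F (prj M G A) \<in> hom ?D (fst F ?E) (fst F G)" by (rule functors_hom[OF F pr])
  have Fv: "\<psi> ?E (var M G A) \<in> el (Tm N) (fst F ?E)"
    using nat_trans_closed[OF \<psi> E v] by (simp add: precomp_def)
  have i: "idt ?C ?E \<in> hom ?C ?E ?E" by (rule category.idt_closed[OF C E])
  have "nt_comp ?C (yo ?C ?E) (tymap M) (yo_el ?C (Tm M) ?E (var M G A)) =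
    nt_comp ?C (yo ?C ?E) (yo_el ?C (Ty M) G A) (yo_map ?C (prj M G A))"
    using natural_model.ext_pullback[OF M G A] by (simp add: is_pullback_def)
  then have "tymap M ?E (yo_el ?C (Tm M) ?E (var M G A) ?E (idt ?C ?E)) =
    yo_el ?C (Ty M) G A ?E (yo_map ?C (prj M G A) ?E (idt ?C ?E))"
    by (rule nt_compD[OF _ E]) (use i in \<open>simp add: yo_def\<close>)
  then have tv: "tymap M ?E (var M G A) = act (Ty M) (prj M G A) A"
    using E i pr v homD[OF pr] natural_model.presheaf_Tm[OF M]
    by (simp add: yo_el_def yo_map_def category.cmp_idt[OF C pr] is_presheaf.act_idt)
  have "tymap N (fst F ?E) (\<psi> ?E (var M G A)) = \<phi> ?E (tymap M ?E (var M G A))"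
    using nt_compD[OF eq E v] E by (simp add: precomp_map_def)
  also have "\<dots> = act (Ty N) (snd F (prj M G A)) (\<phi> G A)"
    using nat_trans_act[OF \<phi> pr A] by (simp add: tv precomp_def)
  finally have c: "tymap N (fst F ?E) (\<psi> ?E (var M G A)) =
      yo_el ?D (Ty N) (fst F G) (\<phi> G A) (fst F ?E) (snd F (prj M G A))"
    using FE Fp by (simp add: yo_el_def)
  let ?H = "ext N (fst F G) (\<phi> G A)"
  have "\<exists>!z. z \<in> el (yo ?D ?H) (fst F ?E) \<and>
      yo_el ?D (Tm N) ?H (var N (fst F G) (\<phi> G A)) (fst F ?E) z = \<psi> ?E (var M G A) \<and>
      yo_map ?D (prj N (fst F G) (\<phi> G A)) (fst F ?E) z = snd F (prj M G A)"
    using is_pullback_pointwise[OF D natural_model.ext_pullback[OF N FG FA] FE Fv _ c] Fp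
    by (simp add: yo_def)
  moreover have "(z \<in> el (yo ?D ?H) (fst F ?E) \<and>
      yo_el ?D (Tm N) ?H (var N (fst F G) (\<phi> G A)) (fst F ?E) z = \<psi> ?E (var M G A) \<and>
      yo_map ?D (prj N (fst F G) (\<phi> G A)) (fst F ?E) z = snd F (prj M G A)) \<longleftrightarrow>
    (z \<in> hom ?D (fst F ?E) ?H \<and> cmp ?D (prj N (fst F G) (\<phi> G A)) z = snd F (prj M G A) \<and>
      act (Tm N) z (var N (fst F G) (\<phi> G A)) = \<psi> ?E (var M G A))" for z
    using FE homD[OF natural_model.prj_closed[OF N FG FA]]
    by (cases "z \<in> hom ?D (fst F ?E) ?H") (auto simp: yo_def yo_el_def yo_map_def)
  ultimately show ?thesis by (simp only:)
qed

lemma lan_eq_equiv: "equiv UNIV (lan_eq C D F P d)"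
  unfolding lan_eq_def
  by (intro equivI refl_rtrancl sym_rtrancl trans_rtrancl) (auto simp: sym_def)

lemma lan_cls_self: "t \<in> lan_cls C D F P d t"
  by (simp add: lan_cls_def lan_eq_def)

lemma lan_cls_step:
  assumes "f \<in> hom C X Y" "g \<in> hom D d (fst F X)" "x \<in> el P Y"
  shows "lan_cls C D F P d (X, g, act P f x) = lan_cls C D F P d (Y, cmp D (snd F f) g, x)"
proof -
  have "((X, g, act P f x), (Y, cmp D (snd F f) g, x)) \<in> lan_step C D F P d"
    using assms by (auto simp: lan_step_def hom_def)
  then have "((X, g, act P f x), (Y, cmp D (snd F f) g, x)) \<in> lan_eq C D F P d"
    unfolding lan_eq_def by blast
  then show ?thesis
    unfolding lan_cls_def by (intro equiv_class_eq[OF lan_eq_equiv])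
qed

lemma lan_eq_invariant:
  assumes "(s, t) \<in> lan_eq C D F P d" "\<And>X Y f g x. f \<in> hom C X Y \<Longrightarrow> g \<in> hom D d (fst F X) \<Longrightarrow>
      x \<in> el P Y \<Longrightarrow> k (X, g, act P f x) = k (Y, cmp D (snd F f) g, x)"
  shows "k s = k t"
  using assms(1) unfolding lan_eq_def
proof (induction rule: rtrancl_induct)
  case (step y z)
  then show ?case using assms(2) homI by (force simp: lan_step_def)
qed simp

lemma lan_cls_invariant:
  assumes "s \<in> lan_cls C D F P d t" "\<And>X Y f g x. f \<in> hom C X Y \<Longrightarrow> g \<in> hom D d (fst F X) \<Longrightarrow>
      x \<in> el P Y \<Longrightarrow> k (X, g, act P f x) = k (Y, cmp D (snd F f) g, x)"
  shows "k s = k t"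
  using lan_eq_invariant[of t s C D F P d k] assms by (simp add: lan_cls_def)

lemma lan_elE:
  assumes "K \<in> el (lan C D F P) d"
  obtains X g x where "X \<in> Ob C" "g \<in> hom D d (fst F X)" "x \<in> el P X"
    "K = lan_cls C D F P d (X, g, x)"
  using assms by (auto simp: lan_def lan_pre_def lan_cls_def quotient_def)

lemma lan_cls_el:
  "X \<in> Ob C \<Longrightarrow> g \<in> hom D d (fst F X) \<Longrightarrow> x \<in> el P X \<Longrightarrow>
    lan_cls C D F P d (X, g, x) \<in> el (lan C D F P) d"
  by (auto simp: lan_def lan_pre_def lan_cls_def intro!: quotientI)

lemma lan_act:
  assumes D: "category D" and F: "F \<in> functors C D" and h: "h \<in> hom D d e"
  shows "act (lan C D F P) h (lan_cls C D F P e (X, g, x)) = lan_cls C D F P d (X, cmp D g h, x)"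
proof -
  let ?k = "\<lambda>(X, g, x). lan_cls C D F P d (X, cmp D g h, x)"
  have "?k s = ?k (X, g, x)" if "s \<in> lan_cls C D F P e (X, g, x)" for s
  proof (rule lan_cls_invariant[OF that])
    fix X Y f g x assume *: "f \<in> hom C X Y" "g \<in> hom D e (fst F X)" "x \<in> el P Y"
    then show "?k (X, g, act P f x) = ?k (Y, cmp D (snd F f) g, x)"
      using lan_cls_step[OF *(1) category.cmp_closed[OF D h *(2)] *(3)]
        category.cmp_assoc[OF D h *(2) functors_hom[OF F *(1)]] by simp
  qed
  then have "(\<Union>s\<in>lan_cls C D F P e (X, g, x). ?k s) = ?k (X, g, x)"
    using lan_cls_self[of "(X, g, x)" C D F P e] by blast
  then show ?thesis using homD[OF h] by (simp add: lan_def)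
qed

lemma is_presheaf_lan:
  assumes D: "category D" and F: "F \<in> functors C D"
  shows "is_presheaf D (lan C D F P)"
proof
  fix f X Y x assume f: "f \<in> hom D X Y" and "x \<in> el (lan C D F P) Y"
  then show "act (lan C D F P) f x \<in> el (lan C D F P) X"
    by (auto elim!: lan_elE simp: lan_act[OF D F f] intro!: lan_cls_el category.cmp_closed[OF D f])
next
  fix X x assume X: "X \<in> Ob D" and "x \<in> el (lan C D F P) X"
  then show "act (lan C D F P) (idt D X) x = x"
    by (auto elim!: lan_elE simp: lan_act[OF D F category.idt_closed[OF D X]] category.cmp_idt[OF D])
next
  fix f X Y g Z x
  assume f: "f \<in> hom D X Y" and g: "g \<in> hom D Y Z" and "x \<in> el (lan C D F P) Z"
  then show "act (lan C D F P) (cmp D g f) x = act (lan C D F P) f (act (lan C D F P) g x)"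
    by (auto elim!: lan_elE simp: lan_act[OF D F f] lan_act[OF D F g]
        lan_act[OF D F category.cmp_closed[OF D f g]] category.cmp_assoc[OF D f g])
qed

lemma lan_map_cls:
  assumes C: "category C" and F: "F \<in> functors C D" and \<phi>: "\<phi> \<in> nat_trans C P Q" and d: "d \<in> Ob D"
    and t: "X \<in> Ob C" "g \<in> hom D d (fst F X)" "x \<in> el P X"
  shows "lan_map C D F P Q \<phi> d (lan_cls C D F P d (X, g, x)) = lan_cls C D F Q d (X, g, \<phi> X x)"
proof -
  let ?k = "\<lambda>(X, g, x). lan_cls C D F Q d (X, g, \<phi> X x)"
  have "?k s = ?k (X, g, x)" if "s \<in> lan_cls C D F P d (X, g, x)" for s
  proof (rule lan_cls_invariant[OF that])
    fix X Y f g x assume *: "f \<in> hom C X Y" "g \<in> hom D d (fst F X)" "x \<in> el P Y"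
    have "Y \<in> Ob C \<Longrightarrow> \<phi> Y x \<in> el Q Y" using nat_trans_closed[OF \<phi> _ *(3)] .
    moreover have "\<phi> Y x \<in> el Q Y \<Longrightarrow> ?k (X, g, act P f x) = ?k (Y, cmp D (snd F f) g, x)"
      using lan_cls_step[OF *(1,2)] nat_trans_act[OF \<phi> *(1,3)] by simp
    moreover have "Y \<notin> Ob C \<Longrightarrow> False" using category.hom_Ob[OF C *(1)] by simp
    ultimately show "?k (X, g, act P f x) = ?k (Y, cmp D (snd F f) g, x)" by blast
  qed
  then have "(\<Union>s\<in>lan_cls C D F P d (X, g, x). ?k s) = ?k (X, g, x)"
    using lan_cls_self[of "(X, g, x)" C D F P d] by blast
  then show ?thesis using d lan_cls_el[of X C g D d F x P] t by (simp add: lan_map_def)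
qed

lemma transpose_nt_nat_trans:
  assumes C: "category C" and D: "category D" and F: "F \<in> functors C D"
    and P: "is_presheaf C P" and \<phi>: "\<phi> \<in> nat_trans D (lan C D F P) Q"
  shows "transpose_nt C D F P \<phi> \<in> nat_trans C P (precomp F Q)"
proof (rule nat_transI)
  show "transpose_nt C D F P \<phi> \<in> (\<Pi>\<^sub>E X\<in>Ob C. el P X \<rightarrow>\<^sub>E el (precomp F Q) X)"
    by (auto simp: transpose_nt_def precomp_def functors_Ob[OF F] category.idt_closed[OF D]
        intro!: nat_trans_closed[OF \<phi>] lan_cls_el)
next
  fix X Y f x assume f: "f \<in> hom C X Y" and x: "x \<in> el P Y"
  have XY: "X \<in> Ob C" "Y \<in> Ob C" using category.hom_Ob[OF C f] by auto
  note o = functors_Ob[OF F XY(1)] functors_Ob[OF F XY(2)]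
  note Ff = functors_hom[OF F f]
  let ?c = "lan_cls C D F P"
  have "?c (fst F X) (X, idt D (fst F X), act P f x) = ?c (fst F X) (Y, snd F f, x)"
    using lan_cls_step[OF f category.idt_closed[OF D o(1)] x] category.cmp_idt[OF D Ff] by simp
  also have "\<dots> = act (lan C D F P) (snd F f) (?c (fst F Y) (Y, idt D (fst F Y), x))"
    by (simp add: lan_act[OF D F Ff] category.idt_cmp[OF D Ff])
  finally show "transpose_nt C D F P \<phi> X (act P f x) = act (precomp F Q) f (transpose_nt C D F P \<phi> Y x)"
    using XY x is_presheaf.act_closed[OF P f x] nat_trans_act[OF \<phi> Ff]
      lan_cls_el[OF XY(2) category.idt_closed[OF D o(2)] x]
    by (simp add: transpose_nt_def precomp_def)
qed

lemma lan_nat_trans_cls: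
  assumes D: "category D" and F: "F \<in> functors C D" and \<phi>: "\<phi> \<in> nat_trans D (lan C D F P) Q"
    and X: "X \<in> Ob C" and g: "g \<in> hom D d (fst F X)" and x: "x \<in> el P X"
  shows "\<phi> d (lan_cls C D F P d (X, g, x)) = act Q g (transpose_nt C D F P \<phi> X x)"
  using nat_trans_act[OF \<phi> g
      lan_cls_el[OF X category.idt_closed[OF D functors_Ob[OF F X]] x]]
    X x
  by (simp add: transpose_nt_def lan_act[OF D F g] category.idt_cmp[OF D g])

lemma bij_betw_transpose_nt:
  assumes C: "category C" and D: "category D" and F: "F \<in> functors C D"
    and P: "is_presheaf C P" and Q: "is_presheaf D Q"
  shows "bij_betw (transpose_nt C D F P) (nat_trans D (lan C D F P) Q)
    (nat_trans C P (precomp F Q))"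
proof (intro bij_betw_imageI inj_onI equalityI subsetI)
  fix \<phi> \<psi> assume \<phi>: "\<phi> \<in> nat_trans D (lan C D F P) Q" and \<psi>: "\<psi> \<in> nat_trans D (lan C D F P) Q"
    and eq: "transpose_nt C D F P \<phi> = transpose_nt C D F P \<psi>"
  show "\<phi> = \<psi>"
    by (rule nat_trans_ext[OF \<phi> \<psi>])
      (auto elim!: lan_elE simp: lan_nat_trans_cls[OF D F \<phi>] lan_nat_trans_cls[OF D F \<psi>] eq)
next
  fix \<chi> assume "\<chi> \<in> transpose_nt C D F P ` nat_trans D (lan C D F P) Q"
  then show "\<chi> \<in> nat_trans C P (precomp F Q)"
    using transpose_nt_nat_trans[OF C D F P] by auto
next
  fix \<chi> assume \<chi>: "\<chi> \<in> nat_trans C P (precomp F Q)"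
  let ?k = "\<lambda>(X, g, x). act Q g (\<chi> X x)"
  define \<phi> where "\<phi> = (\<lambda>d\<in>Ob D. \<lambda>K\<in>el (lan C D F P) d. ?k (SOME s. s \<in> K))"
  have inv: "?k s = ?k t" if "s \<in> lan_cls C D F P d t" for s t d
  proof (rule lan_cls_invariant[OF that])
    fix X Y f g x assume f: "f \<in> hom C X Y" and g: "g \<in> hom D d (fst F X)" and x: "x \<in> el P Y"
    have "\<chi> Y x \<in> el Q (fst F Y)"
      using nat_trans_closed[OF \<chi> _ x] category.hom_Ob[OF C f] by (simp add: precomp_def)
    then show "?k (X, g, act P f x) = ?k (Y, cmp D (snd F f) g, x)"
      using nat_trans_act[OF \<chi> f x] is_presheaf.act_cmp[OF Q g functors_hom[OF F f]]
      by (simp add: precomp_def)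
  qed
  have \<phi>_cls: "\<phi> d (lan_cls C D F P d (X, g, x)) = act Q g (\<chi> X x)"
    if "d \<in> Ob D" "X \<in> Ob C" "g \<in> hom D d (fst F X)" "x \<in> el P X" for d X g x
  proof -
    have "(SOME s. s \<in> lan_cls C D F P d (X, g, x)) \<in> lan_cls C D F P d (X, g, x)"
      using lan_cls_self by (rule someI)
    then show ?thesis
      using inv that lan_cls_el[of X C g D d F x P] by (fastforce simp: \<phi>_def)
  qed
  have "\<phi> \<in> nat_trans D (lan C D F P) Q"
  proof (rule nat_transI)
    have "\<phi> d K \<in> el Q d" if "d \<in> Ob D" "K \<in> el (lan C D F P) d" for d K
      using that nat_trans_closed[OF \<chi>]
      by (auto elim!: lan_elE simp: \<phi>_cls precomp_def intro!: is_presheaf.act_closed[OF Q])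
    then show "\<phi> \<in> (\<Pi>\<^sub>E d\<in>Ob D. el (lan C D F P) d \<rightarrow>\<^sub>E el Q d)"
      by (auto simp: PiE_def Pi_def extensional_def) (simp_all add: \<phi>_def)
  next
    fix d e h K assume h: "h \<in> hom D d e" and "K \<in> el (lan C D F P) e"
    then obtain X g x where K: "X \<in> Ob C" "g \<in> hom D e (fst F X)" "x \<in> el P X"
      "K = lan_cls C D F P e (X, g, x)" by (auto elim!: lan_elE)
    have "\<chi> X x \<in> el Q (fst F X)" using nat_trans_closed[OF \<chi> K(1,3)] by (simp add: precomp_def)
    then show "\<phi> d (act (lan C D F P) h K) = act Q h (\<phi> e K)"
      using K category.hom_Ob[OF D h] category.cmp_closed[OF D h K(2)] is_presheaf.act_cmp[OF Q h K(2)]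
      by (simp add: lan_act[OF D F h] \<phi>_cls)
  qed
  moreover have "transpose_nt C D F P \<phi> = \<chi>"
  proof (rule nat_trans_ext[OF transpose_nt_nat_trans[OF C D F P calculation] \<chi>])
    fix X x assume X: "X \<in> Ob C" and x: "x \<in> el P X"
    have "\<chi> X x \<in> el Q (fst F X)" using nat_trans_closed[OF \<chi> X x] by (simp add: precomp_def)
    then show "transpose_nt C D F P \<phi> X x = \<chi> X x"
      using X x functors_Ob[OF F X]
      by (simp add: transpose_nt_def \<phi>_cls category.idt_closed[OF D] is_presheaf.act_idt[OF Q])
  qed
  ultimately show "\<chi> \<in> transpose_nt C D F P ` nat_trans D (lan C D F P) Q" by blast
qed

text \<open>On representables the left adjoint agrees with \<open>F\<close> up to this isomorphism.\<close>

lemma bij_betw_lan_yo: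
  assumes C: "category C" and D: "category D" and F: "F \<in> functors C D"
    and X: "X \<in> Ob C"
  shows "bij_betw (\<lambda>g. lan_cls C D F (yo C X) d (X, g, idt C X))
    (hom D d (fst F X)) (el (lan C D F (yo C X)) d)"
proof (intro bij_betw_imageI inj_onI equalityI subsetI)
  note i = category.idt_closed[OF C X]
  fix g h assume g: "g \<in> hom D d (fst F X)" and h: "h \<in> hom D d (fst F X)"
    and eq: "lan_cls C D F (yo C X) d (X, g, idt C X) = lan_cls C D F (yo C X) d (X, h, idt C X)"
  let ?k = "\<lambda>(Y, g, x). cmp D (snd F x) g"
  have "(X, g, idt C X) \<in> lan_cls C D F (yo C X) d (X, h, idt C X)"
    using lan_cls_self[of "(X, g, idt C X)"] by (simp add: eq[symmetric])
  then have "?k (X, g, idt C X) = ?k (X, h, idt C X)"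
  proof (rule lan_cls_invariant)
    fix Y Z f g x
    assume f: "f \<in> hom C Y Z" and g: "g \<in> hom D d (fst F Y)" and "x \<in> el (yo C X) Z"
    then have x: "x \<in> hom C Z X" by (simp add: yo_def)
    show "?k (Y, g, act (yo C X) f x) = ?k (Z, cmp D (snd F f) g, x)"
      using category.cmp_assoc[OF D g functors_hom[OF F f] functors_hom[OF F x]]
      by (simp add: yo_def functors_cmp[OF F f x])
  qed
  then show "g = h"
    using category.idt_cmp[OF D g] category.idt_cmp[OF D h] by (simp add: functors_idt[OF F X])
next
  fix K assume "K \<in> (\<lambda>g. lan_cls C D F (yo C X) d (X, g, idt C X)) ` hom D d (fst F X)"
  then show "K \<in> el (lan C D F (yo C X)) d"
    using category.idt_closed[OF C X] by (auto intro!: lan_cls_el[OF X] simp: yo_def)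
next
  fix K assume "K \<in> el (lan C D F (yo C X)) d"
  then obtain Y g x where K: "g \<in> hom D d (fst F Y)" "x \<in> hom C Y X"
    "K = lan_cls C D F (yo C X) d (Y, g, x)" by (auto elim!: lan_elE simp: yo_def)
  have "K = lan_cls C D F (yo C X) d (X, cmp D (snd F x) g, idt C X)"
    using lan_cls_step[OF K(2,1), of "idt C X" "yo C X"] category.idt_closed[OF C X] K(3)
    by (simp add: yo_def category.idt_cmp[OF C K(2)])
  then show "K \<in> (\<lambda>g. lan_cls C D F (yo C X) d (X, g, idt C X)) ` hom D d (fst F X)"
    using category.cmp_closed[OF D K(1) functors_hom[OF F K(2)]] by blast
qed

end

theory Submission
  imports Defs
begin

text \<open>Since types and terms are fibred over contexts, a pair \<open>(FType, FTerm)\<close> respecting contexts is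
  the same as a family of maps on the fibres; respecting substitution is then naturality and
  respecting typing is the premorphism square. As \<open>\<tau>\<close> is the only solution of
  \<open>p \<circ> \<tau> = F p\<close> and \<open>v[\<tau>] = F q\<close>, it is the identity exactly when \<open>F\<close> preserves the chosen
  projection and variable. The second bijection restricts the adjunction \<open>F\<^sub>! \<stileturn> F\<^sup>*\<close>,
  whose transposition turns one premorphism square into the other.\<close>

section \<open>Elementwise forms of naturality and of commuting squares\<close>

text \<open>Running over an object, an element and then an arrow into that object gives the order of
  the substitution clauses of \<open>nm_morphisms\<close>, so the two can be compared by
  rewriting.\<close>

lemma mem_nat_trans_iff:
  "\<phi> \<in> nat_trans C P Q \<longleftrightarrow> \<phi> \<in> (\<Pi>\<^sub>E X\<in>Ob C. el P X \<rightarrow>\<^sub>E el Q X) \<and>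
     (\<forall>X\<in>Ob C. \<forall>x\<in>el P X. \<forall>f\<in>Ar C. cd C f = X \<longrightarrow> \<phi> (dm C f) (act P f x) = act Q f (\<phi> X x))"
  if "category C"
  using category.cd_closed[OF that] by (auto simp: nat_trans_def)

lemma nt_comp_eq_iff:
  "nt_comp C P \<psi> \<phi> = nt_comp C P \<psi>' \<phi>' \<longleftrightarrow>
     (\<forall>X\<in>Ob C. \<forall>x\<in>el P X. \<psi> X (\<phi> X x) = \<psi>' X (\<phi>' X x))"
  by (auto intro!: nt_compI dest: nt_compD)

lemma precomp_simps [simp]:
  "el (precomp F Q) X = el Q (fst F X)" "act (precomp F Q) f = act Q (snd F f)"
  by (simp_all add: precomp_def)

text \<open>Equation \<open>e\<close> gives the identity the codomain required of
  \<open>tau\<close>. By unique existence, \<open>tau\<close> is then the identity as soon as the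
  identity satisfies the defining equations, and the unit laws reduce these to the right-hand
  side.\<close>

lemma tau_eq_idt_iff:
  assumes M: "natural_model M" and N: "natural_model N" and p: "(F, \<phi>, \<psi>) \<in> tr_premorphisms M N"
    and G: "G \<in> Ob (base M)" and A: "A \<in> el (Ty M) G"
    and e: "fst F (ext M G A) = ext N (fst F G) (\<phi> G A)"
  shows "tau M N (F, \<phi>, \<psi>) G A = idt (base N) (fst F (ext M G A)) \<longleftrightarrow>
    snd F (prj M G A) = prj N (fst F G) (\<phi> G A) \<and>
    \<psi> (ext M G A) (var M G A) = var N (fst F G) (\<phi> G A)"
    (is "?t = ?i \<longleftrightarrow> _")
proof -
  let ?P = "\<lambda>t. t \<in> hom (base N) (fst F (ext M G A)) (ext N (fst F G) (\<phi> G A)) \<and>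
     cmp (base N) (prj N (fst F G) (\<phi> G A)) t = snd F (prj M G A) \<and>
     act (Tm N) t (var N (fst F G) (\<phi> G A)) = \<psi> (ext M G A) (var M G A)"
  have F: "F \<in> functors (base M) (base N)" and \<phi>: "\<phi> \<in> nat_trans (base M) (Ty M) (precomp F (Ty N))"
    using p by (auto simp: tr_premorphisms_def)
  have N': "category (base N)" "is_presheaf (base N) (Tm N)"
    using natural_model.category[OF N] natural_model.presheaf_Tm[OF N] .
  have FG: "fst F G \<in> Ob (base N)" and FA: "\<phi> G A \<in> el (Ty N) (fst F G)"
    using functors_Ob[OF F G] nat_trans_closed[OF \<phi> G A] by auto
  note FE = natural_model.ext_closed[OF N FG FA]
  have "?t = ?i \<longleftrightarrow> ?P ?i"
    using theI'[OF tau_ex1[OF M N p G A]] the1_equality[OF tau_ex1[OF M N p G A], of ?i]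
    unfolding tau.simps by (intro iffI) (erule subst)
  also have "\<dots> \<longleftrightarrow> snd F (prj M G A) = prj N (fst F G) (\<phi> G A) \<and>
      \<psi> (ext M G A) (var M G A) = var N (fst F G) (\<phi> G A)"
    using category.idt_closed[OF N'(1) FE]
      category.cmp_idt[OF N'(1) natural_model.prj_closed[OF N FG FA]]
      is_presheaf.act_idt[OF N'(2) FE natural_model.var_closed[OF N FG FA]]
    by (auto simp: e)
  finally show ?thesis .
qed

section \<open>Functions on sorts versus families of maps on fibres\<close>

text \<open>Candidate inverse of \<open>triple_of M\<close>: respecting contexts leaves no choice
  for the first component of a value. The restrictions match the extensional functions of
  \<open>nm_morphisms\<close>.\<close>

definition quadruple_of ::
  "('o1, 'a1, 't1, 'm1) nat_model \<Rightarrow> ('o1, 'a1, 't1, 'm1, 'o2, 'a2, 't2, 'm2) triple \<Rightarrow>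
   ('o1, 'a1, 't1, 'm1, 'o2, 'a2, 't2, 'm2) quadruple" where
  "quadruple_of M = (\<lambda>(F, \<phi>, \<psi>). (fst F, snd F,
     \<lambda>A\<in>Types M. (fst F (fst A), \<phi> (fst A) (snd A)),
     \<lambda>a\<in>Terms M. (fst F (fst a), \<psi> (fst a) (snd a))))"

text \<open>The clauses of a morphism correspond one by one to those of a premorphism. Only bare
  fibre maps are assumed, so the equivalence serves both inclusions of the bijection.\<close>

lemma quadruple_of_mem_iff:
  fixes M :: "('o1, 'a1, 't1, 'm1) nat_model" and N :: "('o2, 'a2, 't2, 'm2) nat_model"
  assumes M: "natural_model M" and N: "natural_model N"
    and \<phi>: "\<phi> \<in> (\<Pi>\<^sub>E G\<in>Ob (base M). el (Ty M) G \<rightarrow>\<^sub>E el (Ty N) (fst F G))"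
    and \<psi>: "\<psi> \<in> (\<Pi>\<^sub>E G\<in>Ob (base M). el (Tm M) G \<rightarrow>\<^sub>E el (Tm N) (fst F G))"
  shows "quadruple_of M (F, \<phi>, \<psi>) \<in> nm_morphisms M N \<longleftrightarrow>
    (F, \<phi>, \<psi>) \<in> tr_premorphisms M N \<and> respects_ext M N (F, \<phi>, \<psi>) \<and> tau_identities M N (F, \<phi>, \<psi>)"
\<comment> \<open>If \<open>F\<close> is not a functor, both sides are false.\<close>
proof (cases "F \<in> functors (base M) (base N)")
  case F: True
  note C = natural_model.category[OF M]
  have dmF: "dm (base N) (snd F f) = fst F (dm (base M) f)"
    and dm_Ob: "dm (base M) f \<in> Ob (base M)" if "f \<in> Ar (base M)" for f
    using functors_hom[OF F homI[OF that]] homD category.dm_closed[OF C that] by fastforce+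
  have FT: "\<phi> G A \<in> el (Ty N) (fst F G)" if "G \<in> Ob (base M)" "A \<in> el (Ty M) G" for G A
    using \<phi> that by auto
  have Ft: "\<psi> G a \<in> el (Tm N) (fst F G)" if "G \<in> Ob (base M)" "a \<in> el (Tm M) G" for G a
    using \<psi> that by auto
  have act_Ty: "act (Ty M) f A \<in> el (Ty M) (dm (base M) f)"
    if "f \<in> Ar (base M)" "A \<in> el (Ty M) (cd (base M) f)" for f A
    using is_presheaf.act_closed[OF natural_model.presheaf_Ty[OF M] homI] that by auto
  have act_Tm: "act (Tm M) f a \<in> el (Tm M) (dm (base M) f)"
    if "f \<in> Ar (base M)" "a \<in> el (Tm M) (cd (base M) f)" for f a
    using is_presheaf.act_closed[OF natural_model.presheaf_Tm[OF M] homI] that by auto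
  have ty: "tymap M G a \<in> el (Ty M) G" if "G \<in> Ob (base M)" "a \<in> el (Tm M) G" for G a
    using nat_trans_closed[OF natural_model.tymap_nat[OF M] that] .
  note ev = natural_model.ext_closed[OF M] natural_model.var_closed[OF M]
  let ?T = "\<lambda>A\<in>Types M. (fst F (fst A), \<phi> (fst A) (snd A))"
  let ?t = "\<lambda>a\<in>Terms M. (fst F (fst a), \<psi> (fst a) (snd a))"
  have "?T \<in> Types M \<rightarrow>\<^sub>E Types N" "?t \<in> Terms M \<rightarrow>\<^sub>E Terms N"
    by (auto simp: Types_def Terms_def FT Ft functors_Ob[OF F])
  moreover have "\<forall>A\<in>Types M. fst (?T A) = fst F (fst A)" "\<forall>a\<in>Terms M. fst (?t a) = fst F (fst a)"
    by simp_all
  \<comment> \<open>The contexts of the two pairs agree by \<open>dmF\<close>, so equality of the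
    pairs is exactly the naturality equation.\<close>
  moreover have "\<phi> \<in> nat_trans (base M) (Ty M) (precomp F (Ty N)) \<longleftrightarrow>
      (\<forall>A\<in>Types M. \<forall>f\<in>Ar (base M). cd (base M) f = fst A \<longrightarrow>
        ?T (ty_subst M A f) = ty_subst N (?T A) (snd F f))"
    using \<phi>
    by (simp add: mem_nat_trans_iff[OF C] Types_def ty_subst_def dmF dm_Ob act_Ty
        cong: conj_cong imp_cong)
  moreover have "\<psi> \<in> nat_trans (base M) (Tm M) (precomp F (Tm N)) \<longleftrightarrow>
      (\<forall>a\<in>Terms M. \<forall>f\<in>Ar (base M). cd (base M) f = fst a \<longrightarrow>
        ?t (tm_subst M a f) = tm_subst N (?t a) (snd F f))"
    using \<psi>
    by (simp add: mem_nat_trans_iff[OF C] Terms_def tm_subst_def dmF dm_Ob act_Tm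
        cong: conj_cong imp_cong)
  moreover have "nt_comp (base M) (Tm M) (precomp_map (base M) F (tymap N)) \<psi> =
        nt_comp (base M) (Tm M) \<phi> (tymap M) \<longleftrightarrow>
      (\<forall>a\<in>Terms M. ?T (type_of M a) = type_of N (?t a))"
    by (auto simp: nt_comp_eq_iff precomp_map_def Terms_def Types_def type_of_def ty)
  moreover have "respects_ext M N (F, \<phi>, \<psi>) \<longleftrightarrow> (\<forall>A\<in>Types M. fst F (Ext M A) = Ext N (?T A))"
    by (auto simp: Types_def Ext_def)
  moreover have "(\<forall>G\<in>Ob (base M). \<forall>A\<in>el (Ty M) G. snd F (prj M G A) = prj N (fst F G) (\<phi> G A)) \<longleftrightarrow>
      (\<forall>A\<in>Types M. snd F (Prj M A) = Prj N (?T A))"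
    by (auto simp: Types_def Prj_def)
  \<comment> \<open>An equation between terms also equates their contexts; this first component is
    \<open>respects_ext\<close>.\<close>
  moreover have "(\<forall>A\<in>Types M. ?t (Var M A) = Var N (?T A)) \<longleftrightarrow>
      respects_ext M N (F, \<phi>, \<psi>) \<and>
      (\<forall>G\<in>Ob (base M). \<forall>A\<in>el (Ty M) G. \<psi> (ext M G A) (var M G A) = var N (fst F G) (\<phi> G A))"
    by (auto simp: Types_def Terms_def Var_def Ext_def ev)
  ultimately have "quadruple_of M (F, \<phi>, \<psi>) \<in> nm_morphisms M N \<longleftrightarrow>
    (F, \<phi>, \<psi>) \<in> tr_premorphisms M N \<and> respects_ext M N (F, \<phi>, \<psi>) \<and>
    (\<forall>G\<in>Ob (base M). \<forall>A\<in>el (Ty M) G. snd F (prj M G A) = prj N (fst F G) (\<phi> G A)) \<and>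
    (\<forall>G\<in>Ob (base M). \<forall>A\<in>el (Ty M) G. \<psi> (ext M G A) (var M G A) = var N (fst F G) (\<phi> G A))"
    \<comment> \<open>The clauses on the functor and the terminal object are shared by both sides;
      the rest is propositional in the equivalences collected above.\<close>
    using F unfolding quadruple_of_def nm_morphisms_def tr_premorphisms_def mem_Collect_eq
      prod.case prod.collapse
    by argo
  \<comment> \<open>The other conjuncts provide the premorphism and the equation \<open>e\<close>
    that \<open>tau_eq_idt_iff\<close> asks for.\<close>
  then show ?thesis
    using tau_eq_idt_iff[OF M N, of F \<phi> \<psi>] by (auto simp: tau_identities_def)
qed (auto simp: quadruple_of_def nm_morphisms_def tr_premorphisms_def)

lemma triple_of_quadruple_of:
  assumes "p \<in> tr_premorphisms M N"
  shows "triple_of M (quadruple_of M p) = p"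
proof -
  obtain F \<phi> \<psi> where p: "p = (F, \<phi>, \<psi>)" by (cases p)
  have "\<phi> \<in> nat_trans (base M) (Ty M) (precomp F (Ty N))"
    "\<psi> \<in> nat_trans (base M) (Tm M) (precomp F (Tm N))"
    using assms by (auto simp: p tr_premorphisms_def)
  \<comment> \<open>Restricting again changes nothing, since natural transformations are extensional
    both in the object and on each fibre.\<close>
  then have "(\<lambda>G\<in>Ob (base M). \<lambda>A\<in>el (Ty M) G. \<phi> G A) = \<phi>"
    "(\<lambda>G\<in>Ob (base M). \<lambda>a\<in>el (Tm M) G. \<psi> G a) = \<psi>"
    by (auto simp: nat_trans_def fun_eq_iff restrict_def PiE_iff extensional_def)
  then show ?thesis
    by (simp add: p quadruple_of_def Types_def Terms_def cong: restrict_cong)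
qed

text \<open>\<open>triple_of\<close> discards the contexts of the values, and respect for contexts
  recovers them; outside the sorts both sides are \<open>undefined\<close>.\<close>

lemma quadruple_of_triple_of:
  assumes "q \<in> nm_morphisms M N"
  shows "quadruple_of M (triple_of M q) = q"
proof -
  obtain FCtx FSub FType FTerm where q: "q = (FCtx, FSub, FType, FTerm)" by (cases q)
  have "FType \<in> extensional (Types M)" "FTerm \<in> extensional (Terms M)"
    "\<And>A. A \<in> Types M \<Longrightarrow> fst (FType A) = FCtx (fst A)"
    "\<And>a. a \<in> Terms M \<Longrightarrow> fst (FTerm a) = FCtx (fst a)"
    using assms by (auto simp: q nm_morphisms_def PiE_iff)
  then show ?thesis
    by (auto simp: q quadruple_of_def Types_def Terms_def fun_eq_iff restrict_def extensional_def
        intro!: prod_eqI)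
qed

text \<open>Provides the hypotheses of \<open>quadruple_of_mem_iff\<close>: a value over
  \<open>G\<close> lies in the fibre over \<open>FCtx G\<close> because contexts are
  respected.\<close>

lemma triple_of_fibres:
  assumes "q \<in> nm_morphisms M N" "triple_of M q = (F, \<phi>, \<psi>)"
  shows "\<phi> \<in> (\<Pi>\<^sub>E G\<in>Ob (base M). el (Ty M) G \<rightarrow>\<^sub>E el (Ty N) (fst F G))"
    and "\<psi> \<in> (\<Pi>\<^sub>E G\<in>Ob (base M). el (Tm M) G \<rightarrow>\<^sub>E el (Tm N) (fst F G))"
proof -
  obtain FCtx FSub FType FTerm where q: "q = (FCtx, FSub, FType, FTerm)" by (cases q)
  have FType: "FType (G, A) \<in> Types N" "fst (FType (G, A)) = FCtx G"
    if "G \<in> Ob (base M)" "A \<in> el (Ty M) G" for G A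
  proof -
    have "(G, A) \<in> Types M" using that by (simp add: Types_def)
    moreover have "FType \<in> Types M \<rightarrow>\<^sub>E Types N" "\<forall>A\<in>Types M. fst (FType A) = FCtx (fst A)"
      using assms(1) by (simp_all add: q nm_morphisms_def)
    ultimately show "FType (G, A) \<in> Types N" "fst (FType (G, A)) = FCtx G" by auto
  qed
  have "snd (FType (G, A)) \<in> el (Ty N) (FCtx G)" if "G \<in> Ob (base M)" "A \<in> el (Ty M) G" for G A
    using FType[OF that] by (cases "FType (G, A)") (simp add: Types_def)
  then show "\<phi> \<in> (\<Pi>\<^sub>E G\<in>Ob (base M). el (Ty M) G \<rightarrow>\<^sub>E el (Ty N) (fst F G))"
    using assms(2) by (auto simp: q)
  have FTerm: "FTerm (G, a) \<in> Terms N" "fst (FTerm (G, a)) = FCtx G"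
    if "G \<in> Ob (base M)" "a \<in> el (Tm M) G" for G a
  proof -
    have "(G, a) \<in> Terms M" using that by (simp add: Terms_def)
    moreover have "FTerm \<in> Terms M \<rightarrow>\<^sub>E Terms N" "\<forall>a\<in>Terms M. fst (FTerm a) = FCtx (fst a)"
      using assms(1) by (simp_all add: q nm_morphisms_def)
    ultimately show "FTerm (G, a) \<in> Terms N" "fst (FTerm (G, a)) = FCtx G" by auto
  qed
  have "snd (FTerm (G, a)) \<in> el (Tm N) (FCtx G)" if "G \<in> Ob (base M)" "a \<in> el (Tm M) G" for G a
    using FTerm[OF that] by (cases "FTerm (G, a)") (simp add: Terms_def)
  then show "\<psi> \<in> (\<Pi>\<^sub>E G\<in>Ob (base M). el (Tm M) G \<rightarrow>\<^sub>E el (Tm N) (fst F G))"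
    using assms(2) by (auto simp: q)
qed

lemma bij_betw_triple_of:
  assumes M: "natural_model M" and N: "natural_model N"
  shows "bij_betw (triple_of M) (nm_morphisms M N)
    {p \<in> tr_premorphisms M N. respects_ext M N p \<and> tau_identities M N p}"
proof (rule bij_betw_byWitness[where f' = "quadruple_of M"])
  show "triple_of M ` nm_morphisms M N \<subseteq>
      {p \<in> tr_premorphisms M N. respects_ext M N p \<and> tau_identities M N p}"
  proof (intro image_subsetI)
    fix q assume q: "q \<in> nm_morphisms M N"
    obtain F \<phi> \<psi> where p: "triple_of M q = (F, \<phi>, \<psi>)" by (cases "triple_of M q")
    show "triple_of M q \<in> {p \<in> tr_premorphisms M N. respects_ext M N p \<and> tau_identities M N p}"
      using quadruple_of_mem_iff[OF M N triple_of_fibres[OF q p]] quadruple_of_triple_of[OF q] q p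
      by simp
  qed
  show "quadruple_of M ` {p \<in> tr_premorphisms M N. respects_ext M N p \<and> tau_identities M N p} \<subseteq>
      nm_morphisms M N"
  proof (intro image_subsetI)
    fix p assume p: "p \<in> {p \<in> tr_premorphisms M N. respects_ext M N p \<and> tau_identities M N p}"
    obtain F \<phi> \<psi> where p': "p = (F, \<phi>, \<psi>)" by (cases p)
    have "\<phi> \<in> (\<Pi>\<^sub>E G\<in>Ob (base M). el (Ty M) G \<rightarrow>\<^sub>E el (Ty N) (fst F G))"
      "\<psi> \<in> (\<Pi>\<^sub>E G\<in>Ob (base M). el (Tm M) G \<rightarrow>\<^sub>E el (Tm N) (fst F G))"
      using p by (simp_all add: p' tr_premorphisms_def nat_trans_def)
    then show "quadruple_of M p \<in> nm_morphisms M N"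
      using quadruple_of_mem_iff[OF M N] p by (simp add: p')
  qed
qed (auto simp: triple_of_quadruple_of quadruple_of_triple_of)

section \<open>Transposing premorphisms along the adjunction\<close>

text \<open>Forwards, evaluate at the unit classes of \<open>(X, id, x)\<close>. Backwards, every
  class of \<open>(X, g, x)\<close> is the restriction along \<open>g\<close> of a unit class, so
  naturality spreads the equation to all elements.\<close>

lemma transpose_square_iff:
  assumes C: "category C" and D: "category D" and F: "F \<in> functors C D"
    and \<phi>: "\<phi> \<in> nat_trans D (lan C D F P) P'" and \<psi>: "\<psi> \<in> nat_trans D (lan C D F Q) Q'"
    and r: "r \<in> nat_trans C Q P" and s: "s \<in> nat_trans D Q' P'"
    and Q: "is_presheaf C Q"
  shows "nt_comp D (lan C D F Q) s \<psi> = nt_comp D (lan C D F Q) \<phi> (lan_map C D F Q P r) \<longleftrightarrow>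
    nt_comp C Q (precomp_map C F s) (transpose_nt C D F Q \<psi>) =
    nt_comp C Q (transpose_nt C D F P \<phi>) r"
    (is "?l \<longleftrightarrow> ?r")
proof
  assume l: ?l
  show ?r
  proof (rule nt_compI)
    fix X x assume X: "X \<in> Ob C" and x: "x \<in> el Q X"
    note FX = functors_Ob[OF F X]
    note i = category.idt_closed[OF D FX]
    show "precomp_map C F s X (transpose_nt C D F Q \<psi> X x) = transpose_nt C D F P \<phi> X (r X x)"
      using nt_compD[OF l FX lan_cls_el[OF X i x]] X x nat_trans_closed[OF r X x]
      by (simp add: precomp_map_def transpose_nt_def lan_map_cls[OF C F r FX X i x])
  qed
next
  assume r': ?r
  show ?l
  proof (rule nt_compI)
    fix d K assume d: "d \<in> Ob D" and "K \<in> el (lan C D F Q) d"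
    then obtain X g x where X: "X \<in> Ob C" and g: "g \<in> hom D d (fst F X)" and x: "x \<in> el Q X"
      and K: "K = lan_cls C D F Q d (X, g, x)" by (auto elim: lan_elE)
    have "transpose_nt C D F Q \<psi> X x \<in> el Q' (fst F X)"
      using nat_trans_closed[OF transpose_nt_nat_trans[OF C D F Q \<psi>] X x] by simp
    \<comment> \<open>Naturality of \<open>\<psi>\<close> and of \<open>s\<close> moves the
      restriction along \<open>g\<close> to the outside.\<close>
    then have "s d (\<psi> d K) = act P' g (s (fst F X) (transpose_nt C D F Q \<psi> X x))"
      by (simp add: K lan_nat_trans_cls[OF D F \<psi> X g x] nat_trans_act[OF s g])
    also have "\<dots> = act P' g (transpose_nt C D F P \<phi> X (r X x))"
      using nt_compD[OF r' X x] X by (simp add: precomp_map_def)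
    also have "\<dots> = \<phi> d (lan_map C D F Q P r d K)"
      using lan_nat_trans_cls[OF D F \<phi> X g nat_trans_closed[OF r X x]]
      by (simp add: K lan_map_cls[OF C F r d X g x])
    finally show "s d (\<psi> d K) = \<phi> d (lan_map C D F Q P r d K)" .
  qed
qed

text \<open>For each fixed functor this is the adjunction bijection in both components, cut down by
  squares that correspond under transposition.\<close>

lemma bij_betw_tr_premorphism:
  assumes M: "natural_model M" and N: "natural_model N"
  shows "bij_betw (tr_premorphism M N) (premorphisms M N) (tr_premorphisms M N)"
proof -
  note C = natural_model.category[OF M] and D = natural_model.category[OF N]
  \<comment> \<open>The functor stays open here, as it varies with the premorphism.\<close>
  note sq = transpose_square_iff[OF C D _ _ _ natural_model.tymap_nat[OF M]
      natural_model.tymap_nat[OF N] natural_model.presheaf_Tm[OF M]]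
  note bij_Ty = bij_betw_transpose_nt[OF C D _ natural_model.presheaf_Ty[OF M]
      natural_model.presheaf_Ty[OF N]]
  note bij_Tm = bij_betw_transpose_nt[OF C D _ natural_model.presheaf_Tm[OF M]
      natural_model.presheaf_Tm[OF N]]
  show ?thesis
  proof (intro bij_betw_imageI inj_onI equalityI subsetI)
    fix p p' assume "p \<in> premorphisms M N" "p' \<in> premorphisms M N"
      "tr_premorphism M N p = tr_premorphism M N p'"
    then show "p = p'"
      \<comment> \<open>Equal images share their functor, so the components lie in the same sets of
        natural transformations, where transposition is injective.\<close>
      using inj_onD[OF bij_betw_imp_inj_on[OF bij_Ty]] inj_onD[OF bij_betw_imp_inj_on[OF bij_Tm]]
      by (cases p; cases p') (simp add: premorphisms_def, metis)
  next
    fix p assume "p \<in> tr_premorphism M N ` premorphisms M N"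
    then obtain F \<phi> \<psi> where p: "(F, \<phi>, \<psi>) \<in> premorphisms M N"
      and p': "p = tr_premorphism M N (F, \<phi>, \<psi>)" by auto
    then have F: "F \<in> functors (base M) (base N)"
      and \<phi>: "\<phi> \<in> nat_trans (base N) (lan (base M) (base N) F (Ty M)) (Ty N)"
      and \<psi>: "\<psi> \<in> nat_trans (base N) (lan (base M) (base N) F (Tm M)) (Tm N)"
      by (simp_all add: premorphisms_def)
    show "p \<in> tr_premorphisms M N"
      using p sq[OF F \<phi> \<psi>] bij_betwE[OF bij_Ty[OF F]] bij_betwE[OF bij_Tm[OF F]] \<phi> \<psi>
      by (simp add: p' premorphisms_def tr_premorphisms_def)
  next
    fix p assume p: "p \<in> tr_premorphisms M N"
    obtain F \<phi> \<psi> where p': "p = (F, \<phi>, \<psi>)" by (cases p)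
    have F: "F \<in> functors (base M) (base N)" using p by (simp add: p' tr_premorphisms_def)
    obtain \<phi>' where \<phi>': "\<phi>' \<in> nat_trans (base N) (lan (base M) (base N) F (Ty M)) (Ty N)"
      "\<phi> = transpose_nt (base M) (base N) F (Ty M) \<phi>'"
      using p bij_Ty[OF F] by (auto simp: p' tr_premorphisms_def bij_betw_def)
    obtain \<psi>' where \<psi>': "\<psi>' \<in> nat_trans (base N) (lan (base M) (base N) F (Tm M)) (Tm N)"
      "\<psi> = transpose_nt (base M) (base N) F (Tm M) \<psi>'"
      using p bij_Tm[OF F] by (auto simp: p' tr_premorphisms_def bij_betw_def)
    have "(F, \<phi>', \<psi>') \<in> premorphisms M N"
      using p sq[OF F \<phi>'(1) \<psi>'(1)] \<phi>' \<psi>' by (simp add: p' premorphisms_def tr_premorphisms_def)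
    then show "p \<in> tr_premorphism M N ` premorphisms M N"
      by (intro image_eqI[of _ _ "(F, \<phi>', \<psi>')"]) (simp_all add: p' \<phi>' \<psi>')
  qed
qed

theorem theorem2p3p7:
  fixes M :: "('o1, 'a1, 't1, 'm1) nat_model"
    and N :: "('o2, 'a2, 't2, 'm2) nat_model"
  assumes "natural_model M" and "natural_model N"
  shows "bij_betw (triple_of M) (nm_morphisms M N)
           {p \<in> tr_premorphisms M N. respects_ext M N p \<and> tau_identities M N p} \<and>
         bij_betw (tr_premorphism M N)
           {p \<in> premorphisms M N. respects_ext M N (tr_premorphism M N p) \<and>
                                   tau_identities M N (tr_premorphism M N p)}
           {p \<in> tr_premorphisms M N. respects_ext M N p \<and> tau_identities M N p}"
  \<comment> \<open>The conditions on the source of the second map are those on its target, pulled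
    back along transposition, so the bijection restricts.\<close>
  using bij_betw_triple_of[OF assms] by (auto intro: bij_betw_Collect[OF bij_betw_tr_premorphism[OF assms]])

end
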